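(* Let $M_1=(E,\mathcal I_1)$, $M_2=(E,\mathcal I_2)$ be matroids on a common finite ground set $E$, $w:E\to\mathbb R_{\ge0}$, fix any order of $E$ (the stream), and let $S$ be the set generated by Algorithm LR (described in the context). Then there exists $T\subseteq S$ independent in both $M_1$ and $M_2$ with $w(T)\ge w(S^* )/2$, where $S^*$ is an optimal solution of the weighted matroid intersection problem (a maximum-$w$-weight set independent in both matroids).
   Context: For a matroid $M$, $\mathrm{span}_M(X)=\{e\in E:\mathrm{rank}_M(X\cup\{e\})=\mathrm{rank}_M(X)\}$, and $h(A)=\sum_{a\in A}h(a)$. Algorithm LR: initialize $S=\emptyset$; elements of $E$ arrive one at a time in the stream order. When $e$ arrives, for $i=1,2$ compute $w_i^*(e)=\max\bigl(\{0\}\cup\{\theta: e\in\mathrm{span}_{M_i}(\{f\in S:w_i(f)\ge\theta\})\}\bigr)$. If $w(e)>w_1^*(e)+w_2^*(e)$, set $g(e)=w(e)-w_1^*(e)-w_2^*(e)$, $w_i(e)=w_i^*(e)+g(e)$ for $i=1,2$, and add $e$ to $S$; otherwise discard $e$. $S$ is the set at the end of the stream. *)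

theory Defs
  imports "HOL-Library.Extended_Real"
begin

locale matroid =
  fixes E :: "'a set" and \<I> :: "'a set set"
  assumes finite_ground: "finite E"
    and indep_subset_ground: "X \<in> \<I> \<Longrightarrow> X \<subseteq> E"
    and indep_empty: "{} \<in> \<I>"
    and indep_mono: "\<lbrakk>X \<in> \<I>; Y \<subseteq> X\<rbrakk> \<Longrightarrow> Y \<in> \<I>"
    and indep_augment:
      "\<lbrakk>X \<in> \<I>; Y \<in> \<I>; card X < card Y\<rbrakk> \<Longrightarrow> \<exists>e\<in>Y - X. insert e X \<in> \<I>"

definition matroid_rank :: "'a set set \<Rightarrow> 'a set \<Rightarrow> nat" where
  "matroid_rank \<I> X = Max (card ` {Y \<in> \<I>. Y \<subseteq> X})"

definition matroid_span :: "'a set \<Rightarrow> 'a set set \<Rightarrow> 'a set \<Rightarrow> 'a set" where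
  "matroid_span E \<I> X = {e \<in> E. matroid_rank \<I> (insert e X) = matroid_rank \<I> X}"

(* Thresholds range over the extended reals so that the maximum always exists: a loop e
   lies in the span of the empty set, so every threshold qualifies and the value is
   infinite (hence loops are never selected). For a non-loop the value is a finite real.
   The lemma below shows that the supremum is attained. *)
definition w_star ::
    "'a set \<Rightarrow> 'a set set \<Rightarrow> 'a set \<Rightarrow> ('a \<Rightarrow> real) \<Rightarrow> 'a \<Rightarrow> ereal" where
  "w_star E \<I> S wi e =
     Sup ({0} \<union> {\<theta>. e \<in> matroid_span E \<I> {f \<in> S. ereal (wi f) \<ge> \<theta>}})"

lemma w_star_attained:
  assumes "finite S"
  shows "w_star E \<I> S wi e \<in> {0} \<union> {\<theta>. e \<in> matroid_span E \<I> {f \<in> S. ereal (wi f) \<ge> \<theta>}}"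
proof -
  define L where "L = (\<lambda>\<theta>. {f \<in> S. ereal (wi f) \<ge> \<theta>})"
  define A where "A = {0} \<union> {\<theta>. e \<in> matroid_span E \<I> (L \<theta>)}"
  define s where "s = Sup A"
  have "s \<in> A"
  proof (cases "s = 0")
    case True
    then show ?thesis by (simp add: A_def)
  next
    case False
    have "0 \<le> s" unfolding s_def by (rule Sup_upper) (simp add: A_def)
    with False have "0 < s" by (simp add: less_le)
    define V where "V = insert 0 {v \<in> (\<lambda>f. ereal (wi f)) ` S. v < s}"
    have V: "finite V" "V \<noteq> {}" "\<forall>v\<in>V. v < s"
      using assms \<open>0 < s\<close> by (simp_all add: V_def)
    have "Max V < s" using V by (simp add: Max_less_iff)
    then obtain t where t: "t \<in> A" "Max V < t"
      unfolding s_def less_Sup_iff by (rule bexE)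
    have tV: "v < t" if "v \<in> V" for v
      using Max_ge[OF V(1) that] t(2) by (rule le_less_trans)
    have "0 < t" by (rule tV) (simp add: V_def)
    have "t \<le> s" unfolding s_def using t(1) by (rule Sup_upper)
    have "t \<le> ereal (wi f) \<longleftrightarrow> s \<le> ereal (wi f)" if "f \<in> S" for f
    proof
      assume le: "t \<le> ereal (wi f)"
      show "s \<le> ereal (wi f)"
      proof (rule ccontr)
        assume "\<not> s \<le> ereal (wi f)"
        then have "ereal (wi f) \<in> V" using that by (simp add: V_def not_le)
        from tV[OF this] le show False by (simp add: not_le[symmetric])
      qed
    next
      assume "s \<le> ereal (wi f)"
      with \<open>t \<le> s\<close> show "t \<le> ereal (wi f)" by (rule order_trans)
    qed
    then have "L t = L s" unfolding L_def by (intro Collect_cong conj_cong refl)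
    with t(1) \<open>0 < t\<close> show ?thesis by (auto simp: A_def)
  qed
  then show ?thesis unfolding s_def A_def L_def w_star_def .
qed

(* wt1 and wt2 are only ever read at selected elements; their values elsewhere are
   irrelevant. *)
record 'a lr_state =
  selected :: "'a set"
  wt1 :: "'a \<Rightarrow> real"
  wt2 :: "'a \<Rightarrow> real"

definition lr_init :: "'a lr_state" where
  "lr_init = \<lparr>selected = {}, wt1 = (\<lambda>_. 0), wt2 = (\<lambda>_. 0)\<rparr>"

(* In the accepting branch both w_star values are nonnegative with a sum below a real
   number, hence finite, so the conversions to real are exact. *)
definition lr_step ::
    "'a set \<Rightarrow> 'a set set \<Rightarrow> 'a set set \<Rightarrow> ('a \<Rightarrow> real) \<Rightarrow> 'a \<Rightarrow> 'a lr_state \<Rightarrow> 'a lr_state" where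
  "lr_step E \<I>\<^sub>1 \<I>\<^sub>2 w e st =
     (let a1 = w_star E \<I>\<^sub>1 (selected st) (wt1 st) e;
          a2 = w_star E \<I>\<^sub>2 (selected st) (wt2 st) e
      in if ereal (w e) > a1 + a2 then
           (let g = w e - real_of_ereal a1 - real_of_ereal a2
            in \<lparr>selected = insert e (selected st),
                wt1 = (wt1 st)(e := real_of_ereal a1 + g),
                wt2 = (wt2 st)(e := real_of_ereal a2 + g)\<rparr>)
         else st)"

definition lr_output ::
    "'a set \<Rightarrow> 'a set set \<Rightarrow> 'a set set \<Rightarrow> ('a \<Rightarrow> real) \<Rightarrow> 'a list \<Rightarrow> 'a set" where
  "lr_output E \<I>\<^sub>1 \<I>\<^sub>2 w stream = selected (fold (lr_step E \<I>\<^sub>1 \<I>\<^sub>2 w) stream lr_init)"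

definition optimal_common_indep ::
    "'a set set \<Rightarrow> 'a set set \<Rightarrow> ('a \<Rightarrow> real) \<Rightarrow> 'a set \<Rightarrow> bool" where
  "optimal_common_indep \<I>\<^sub>1 \<I>\<^sub>2 w X \<longleftrightarrow>
     X \<in> \<I>\<^sub>1 \<inter> \<I>\<^sub>2 \<and> (\<forall>Y \<in> \<I>\<^sub>1 \<inter> \<I>\<^sub>2. sum w Y \<le> sum w X)"

end

theory Submission
  imports Defs
begin

text \<open>
  Let \<open>a\<^sub>i(e)\<close> be the value \<open>w\<^sub>i\<^sup>*(e)\<close> at the arrival of \<open>e\<close>, and put \<open>g(e) = 0\<close> for discarded elements
  and \<open>u\<^sub>i = a\<^sub>i + g\<close>. By the layer-cake formula, the largest \<open>u\<^sub>i\<close>-weight of an independent subset of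
  \<open>X\<close> is the integral over \<open>v > 0\<close> of the rank of \<open>{f \<in> X. u\<^sub>i f \<ge> v}\<close>. An arriving \<open>e\<close> is spanned by
  the selected elements of level \<open>v\<close> iff \<open>v \<le> a\<^sub>i(e)\<close>, so it raises these ranks only for
  \<open>a\<^sub>i(e) < v \<le> a\<^sub>i(e) + g(e)\<close>, and for exactly these \<open>v\<close> it does so within any subset of \<open>S\<close>. Hence the
  \<open>u\<^sub>i\<close>-weight of any independent set is at most \<open>g(S)\<close>, and a greedy basis of \<open>X \<subseteq> S\<close> has
  \<open>u\<^sub>i\<close>-weight at least \<open>g(X)\<close>. Since \<open>w \<le> u\<^sub>1 + u\<^sub>2\<close>, the optimum is at most \<open>2 g(S)\<close>.

  For \<open>T\<close> take a matroid kernel (Fleiner): sets \<open>X\<^sub>1 \<union> X\<^sub>2 = S\<close> such that \<open>T = X\<^sub>1 \<inter> X\<^sub>2\<close> is the greedy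
  \<open>u\<^sub>i\<close>-basis of \<open>X\<^sub>i\<close> in \<open>M\<^sub>i\<close> for both \<open>i\<close>. On \<open>S\<close> we have \<open>w = u\<^sub>1 + u\<^sub>2 - g\<close>, so
  \<open>w(T) \<ge> g(X\<^sub>1) + g(X\<^sub>2) - g(T) = g(S)\<close>.
\<close>

subsection \<open>Rank and span\<close>

context matroid
begin

lemma finite_indep: "X \<in> \<I> \<Longrightarrow> finite X"
  using finite_ground indep_subset_ground finite_subset by blast

lemma finite_indep_subsets: "finite {Y \<in> \<I>. Y \<subseteq> X}"
  by (rule finite_subset[of _ "Pow E"]) (use indep_subset_ground finite_ground in auto)

lemma card_le_rank: "Y \<in> \<I> \<Longrightarrow> Y \<subseteq> X \<Longrightarrow> card Y \<le> matroid_rank \<I> X"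
  unfolding matroid_rank_def using finite_indep_subsets by (intro Max_ge) auto

lemma rank_attained: "\<exists>B\<in>\<I>. B \<subseteq> X \<and> card B = matroid_rank \<I> X"
proof -
  have "Max (card ` {Y \<in> \<I>. Y \<subseteq> X}) \<in> card ` {Y \<in> \<I>. Y \<subseteq> X}"
    using finite_indep_subsets indep_empty by (intro Max_in) auto
  then show ?thesis unfolding matroid_rank_def by auto
qed

lemma extend_to_basis:
  assumes "Y \<in> \<I>" "Y \<subseteq> X"
  shows "\<exists>B\<in>\<I>. Y \<subseteq> B \<and> B \<subseteq> X \<and> card B = matroid_rank \<I> X"
  using assms
proof (induction "matroid_rank \<I> X - card Y" arbitrary: Y)
  case 0
  then show ?case using card_le_rank[of Y X] by auto
next
  case (Suc n)
  obtain B where B: "B \<in> \<I>" "B \<subseteq> X" "card B = matroid_rank \<I> X"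
    using rank_attained by blast
  with Suc obtain e where e: "e \<in> B - Y" "insert e Y \<in> \<I>"
    using indep_augment[of Y B] by fastforce
  have "card (insert e Y) = Suc (card Y)" using e finite_indep[OF Suc.prems(1)] by simp
  then have "n = matroid_rank \<I> X - card (insert e Y)" using Suc.hyps(2) by simp
  from Suc.hyps(1)[OF this e(2)] show ?case using e B Suc.prems by auto
qed

lemma rank_mono: "X \<subseteq> Y \<Longrightarrow> matroid_rank \<I> X \<le> matroid_rank \<I> Y"
  using rank_attained[of X] card_le_rank[of _ Y] by (metis order_trans)

lemma rank_indep: "X \<in> \<I> \<Longrightarrow> matroid_rank \<I> X = card X"
  using rank_attained[of X] card_le_rank[of X X] finite_indep[of X]
  by (metis card_mono order_antisym order_refl)

lemma indep_if_rank: "finite X \<Longrightarrow> matroid_rank \<I> X = card X \<Longrightarrow> X \<in> \<I>"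
  using rank_attained[of X] by (metis card_subset_eq)

lemma rank_empty: "matroid_rank \<I> {} = 0"
  using rank_indep[OF indep_empty] by simp

lemma rank_insert_le: "matroid_rank \<I> (insert e X) \<le> Suc (matroid_rank \<I> X)"
proof -
  obtain B where B: "B \<in> \<I>" "B \<subseteq> insert e X" "card B = matroid_rank \<I> (insert e X)"
    using rank_attained by blast
  have "card (B - {e}) \<le> matroid_rank \<I> X"
    using B by (intro card_le_rank indep_mono[OF B(1)]) auto
  then show ?thesis using B(3) by (auto simp: card_Diff_singleton_if split: if_splits)
qed

text \<open>Suppose \<open>e\<close> raised the rank of \<open>X\<close>. Extend a basis
  \<open>D\<close> of \<open>Y\<close> to a basis \<open>B\<close> of \<open>X\<close>, and
  \<open>B\<close> to a basis \<open>B'\<close> of \<open>insert e X\<close>. Then \<open>B'\<close>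
  is too large to lie in \<open>X\<close>, so it contains \<open>e\<close>; thus
  \<open>insert e D\<close> is independent and \<open>e\<close> raises the rank of \<open>Y\<close>
  as well.\<close>

lemma span_mono:
  assumes "Y \<subseteq> X" shows "matroid_span E \<I> Y \<subseteq> matroid_span E \<I> X"
proof
  fix e assume e: "e \<in> matroid_span E \<I> Y"
  have "matroid_rank \<I> (insert e X) = matroid_rank \<I> X"
  proof (rule ccontr)
    assume "matroid_rank \<I> (insert e X) \<noteq> matroid_rank \<I> X"
    then have gt: "matroid_rank \<I> X < matroid_rank \<I> (insert e X)"
      using rank_mono[OF subset_insertI[of X e]] by simp
    obtain D where D: "D \<in> \<I>" "D \<subseteq> Y" "card D = matroid_rank \<I> Y"
      using rank_attained by blast
    obtain B where B: "B \<in> \<I>" "D \<subseteq> B" "B \<subseteq> X" "card B = matroid_rank \<I> X"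
      using extend_to_basis[of D X] D assms by auto
    obtain B' where B': "B' \<in> \<I>" "B \<subseteq> B'" "B' \<subseteq> insert e X"
        "card B' = matroid_rank \<I> (insert e X)"
      using extend_to_basis[of B "insert e X"] B by auto
    have "e \<in> B'" using card_le_rank[of B' X] B' gt by auto
    moreover have "e \<notin> Y" using gt assms by (metis insert_absorb nat_less_le subsetD)
    ultimately have "insert e D \<in> \<I>" "e \<notin> D"
      using indep_mono[OF B'(1), of "insert e D"] B B' D by auto
    then have "card D < matroid_rank \<I> (insert e Y)"
      using card_le_rank[OF _ insert_mono[OF D(2)], of e] D(3) finite_indep[OF D(1)] by simp
    with e D show False by (simp add: matroid_span_def)
  qed
  with e show "e \<in> matroid_span E \<I> X" by (simp add: matroid_span_def)
qed

lemma rank_insert: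
  assumes "e \<in> E"
  shows "matroid_rank \<I> (insert e X) =
    (if e \<in> matroid_span E \<I> X then matroid_rank \<I> X else Suc (matroid_rank \<I> X))"
  using assms rank_insert_le[of e X] rank_mono[OF subset_insertI[of X e]]
  by (simp add: matroid_span_def)

lemma nonloop_iff:
  assumes "e \<in> E" shows "{e} \<in> \<I> \<longleftrightarrow> e \<notin> matroid_span E \<I> {}"
proof -
  have "{e} \<in> \<I> \<longleftrightarrow> matroid_rank \<I> {e} = 1"
    using rank_indep[of "{e}"] indep_if_rank[of "{e}"] by fastforce
  then show ?thesis using rank_insert[OF assms, of "{}"] rank_empty by simp
qed

subsection \<open>Greedy bases\<close>

text \<open>For injective \<open>r\<close> this is the output of the greedy algorithm scanning
  \<open>X\<close> by decreasing \<open>r\<close>. Testing against all higher elements, instead of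
  only those kept so far, makes the rejected part visibly monotone in \<open>X\<close>, which the
  kernel construction needs.\<close>

definition greedy :: "('a \<Rightarrow> nat) \<Rightarrow> 'a set \<Rightarrow> 'a set" where
  "greedy r X = {e \<in> X. e \<notin> matroid_span E \<I> {f \<in> X. r e < r f}}"

lemma greedy_subset: "greedy r X \<subseteq> X"
  by (auto simp: greedy_def)

lemma greedy_basis:
  assumes "finite X" "X \<subseteq> E" "inj_on r X"
  shows "greedy r X \<in> \<I> \<and> card (greedy r X) = matroid_rank \<I> X"
  using assms
\<comment> \<open>The induction rule inserts an element of largest value. The negated ranking makes
  this the element of lowest \<open>r\<close>, so the levels above the old elements stay the same
  and the level above the new one is all of \<open>X\<close>.\<close>
proof (induction X rule: finite_ranking_induct[where f = "\<lambda>x. - int (r x)"])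
  case empty
  then show ?case by (simp add: greedy_def indep_empty rank_empty)
next
  case (insert e X)
  have IH: "greedy r X \<in> \<I>" "card (greedy r X) = matroid_rank \<I> X"
    using insert by (auto simp: inj_on_insert)
  show ?case
  proof (cases "e \<in> X")
    case True
    then show ?thesis using IH by (simp add: insert_absorb)
  next
    case False
    have less: "r e < r f" if "f \<in> X" for f
    proof -
      have "r e \<le> r f" using insert.hyps(2)[OF that] by simp
      moreover have "r e \<noteq> r f"
        using inj_onD[OF insert.prems(2), of e f] that False by auto
      ultimately show ?thesis by simp
    qed
    have levels: "{f \<in> insert e X. r x < r f} = {f \<in> X. r x < r f}" if "x \<in> X" for x
      using less[OF that] by auto
    have level_e: "{f \<in> insert e X. r e < r f} = X" using less by auto
    have *: "greedy r (insert e X) =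
        (if e \<in> matroid_span E \<I> X then greedy r X else insert e (greedy r X))"
      using levels level_e by (auto simp: greedy_def)
    show ?thesis
    proof (cases "e \<in> matroid_span E \<I> X")
      case True
      then show ?thesis using * IH insert.prems rank_insert[of e X] by simp
    next
      case notin: False
      have fin: "finite (greedy r X)" by (rule finite_indep[OF IH(1)])
      have "e \<notin> greedy r X" using False greedy_subset by blast
      then have card: "card (insert e (greedy r X)) = Suc (card (greedy r X))"
        using fin by simp
      have "e \<notin> matroid_span E \<I> (greedy r X)"
        using notin span_mono[OF greedy_subset[of r X]] by auto
      then have "matroid_rank \<I> (insert e (greedy r X)) = Suc (card (greedy r X))"
        using rank_insert[of e "greedy r X"] insert.prems rank_indep[OF IH(1)] by simp
      then have "insert e (greedy r X) \<in> \<I>" using indep_if_rank fin card by simp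
      then show ?thesis using * notin card IH insert.prems rank_insert[of e X] by simp
    qed
  qed
qed

text \<open>Since \<open>r\<close> refines \<open>u\<close>, the level set of \<open>v\<close> is
  closed upwards under \<open>r\<close> within \<open>X\<close>. Greedy on it therefore makes the
  same decisions as greedy on \<open>X\<close>.\<close>

lemma card_greedy_level:
  fixes u :: "'a \<Rightarrow> real"
  assumes "finite X" "X \<subseteq> E" "inj_on r X"
    and "\<And>e f. e \<in> X \<Longrightarrow> f \<in> X \<Longrightarrow> r e < r f \<Longrightarrow> u e \<le> u f"
  shows "card {e \<in> greedy r X. v \<le> u e} = matroid_rank \<I> {e \<in> X. v \<le> u e}"
proof -
  have "{f \<in> {e \<in> X. v \<le> u e}. r x < r f} = {f \<in> X. r x < r f}" if "x \<in> X" "v \<le> u x" for x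
    using that assms(4)[of x] by force
  then have "greedy r {e \<in> X. v \<le> u e} = {e \<in> greedy r X. v \<le> u e}"
    by (auto simp: greedy_def)
  moreover have "inj_on r {e \<in> X. v \<le> u e}" using assms(3) by (rule inj_on_subset) auto
  ultimately show ?thesis using greedy_basis[of "{e \<in> X. v \<le> u e}" r] assms by auto
qed

end

text \<open>Breaks the ties of a real weight, so that greedy bases for that weight can be taken with
  an injective ranking.\<close>

lemma ex_refining_ranking:
  fixes u :: "'a \<Rightarrow> real"
  assumes "finite X"
  shows "\<exists>r :: 'a \<Rightarrow> nat. inj_on r X \<and> (\<forall>e\<in>X. \<forall>f\<in>X. r e < r f \<longrightarrow> u e \<le> u f)"
  using assms
proof (induction X rule: finite_ranking_induct[where f = u])
  case (insert x X)
  then obtain r :: "'a \<Rightarrow> nat" where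
    r: "inj_on r X" "\<forall>e\<in>X. \<forall>f\<in>X. r e < r f \<longrightarrow> u e \<le> u f" by blast
  \<comment> \<open>The inserted \<open>x\<close> has the largest weight, so it is placed above
    every rank in use.\<close>
  define N where "N = Suc (Max (insert 0 (r ` X)))"
  have N: "r y < N" if "y \<in> X" for y
    unfolding N_def using insert.hyps(1) that by (simp add: le_imp_less_Suc)
  show ?case
  proof (cases "x \<in> X")
    case True
    then show ?thesis using r by (auto simp: insert_absorb)
  next
    case False
    have "inj_on (r(x := N)) (insert x X)"
      using r(1) N False by (force simp: inj_on_def)
    moreover have "\<forall>e\<in>insert x X. \<forall>f\<in>insert x X. (r(x := N)) e < (r(x := N)) f \<longrightarrow> u e \<le> u f"
    proof (intro ballI impI)
      fix e f assume ef: "e \<in> insert x X" "f \<in> insert x X" "(r(x := N)) e < (r(x := N)) f"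
      have "(r(x := N)) f \<le> N" using N[of f] ef(2) by auto
      then have "e \<noteq> x" using ef(3) by auto
      then show "u e \<le> u f" using ef r(2) insert.hyps(2) by (auto split: if_splits)
    qed
    ultimately show ?thesis by blast
  qed
qed simp

subsection \<open>Layer-cake sums\<close>

text \<open>\<open>m v\<close> is the distance from \<open>v\<close> to its predecessor in \<open>V \<union> {0}\<close>, so that sums over \<open>V\<close> weighted
  by \<open>m\<close> stand in for integrals of step functions with jumps in \<open>V\<close>.\<close>

lemma ex_increments:
  fixes V :: "real set"
  assumes "finite V" "\<forall>v\<in>V. 0 < v"
  shows "\<exists>m. (\<forall>v. 0 \<le> m v) \<and> (\<forall>x\<in>insert 0 V. (\<Sum>v | v \<in> V \<and> v \<le> x. m v) = x)"
  using assms
proof (induction V rule: finite_linorder_max_induct)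
  case (insert b V)
  then obtain m where m: "\<forall>v. 0 \<le> m v"
    "\<forall>x\<in>insert 0 V. (\<Sum>v | v \<in> V \<and> v \<le> x. m v) = x" by auto
  \<comment> \<open>The level just below \<open>b\<close>, or 0 if \<open>V\<close> is empty. The
    increments up to \<open>c\<close> add up to \<open>c\<close>, hence \<open>b\<close> receives
    the increment \<open>b - c\<close>.\<close>
  define c where "c = Max (insert 0 V)"
  have c: "c \<in> insert 0 V" "\<forall>v\<in>V. v \<le> c" "c < b" "0 \<le> c"
    using insert Max_in[of "insert 0 V"] Max_ge[of "insert 0 V"]
    unfolding c_def by (auto simp del: Max_insert Max_in Max_ge)
  have "{v. v \<in> V \<and> v \<le> c} = V" using c by auto
  then have sumV: "sum m V = c" using m(2) c(1) by force
  have bV: "b \<notin> V" using insert.hyps by auto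
  have old: "(\<Sum>v | v \<in> insert b V \<and> v \<le> x. (m(b := b - c)) v) = x" if "x \<in> insert 0 V" for x
  proof -
    have "x < b" using that insert by auto
    then have "{v. v \<in> insert b V \<and> v \<le> x} = {v. v \<in> V \<and> v \<le> x}" by auto
    moreover have "(\<Sum>v | v \<in> V \<and> v \<le> x. (m(b := b - c)) v) = (\<Sum>v | v \<in> V \<and> v \<le> x. m v)"
      using bV by (intro sum.cong) auto
    ultimately show ?thesis using m(2) that by auto
  qed
  have "{v. v \<in> insert b V \<and> v \<le> b} = insert b V" using insert.hyps by force
  moreover have "sum (m(b := b - c)) V = sum m V" using bV by (intro sum.cong) auto
  ultimately have "(\<Sum>v | v \<in> insert b V \<and> v \<le> b. (m(b := b - c)) v) = b"
    using bV insert.hyps(1) sumV by simp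
  then show ?case using old m(1) c(3) by (intro exI[of _ "m(b := b - c)"]) auto
qed (auto intro: exI[of _ "\<lambda>_. 0"])

lemma ex_increments_at_levels:
  fixes a g :: "'a \<Rightarrow> real" and xs :: "'a list"
  assumes "\<And>e. 0 \<le> a e" "\<And>e. 0 \<le> g e"
  shows "\<exists>V m. finite V \<and> (\<forall>v\<in>V. 0 < v) \<and> (\<forall>v. 0 \<le> m v) \<and>
    (\<forall>x\<in>insert 0 V. (\<Sum>v | v \<in> V \<and> v \<le> x. m v) = x) \<and>
    (\<forall>e\<in>set xs. a e \<in> insert 0 V \<and> a e + g e \<in> insert 0 V)"
proof -
  define V where "V = {v \<in> a ` set xs \<union> (\<lambda>e. a e + g e) ` set xs. 0 < v}"
  have V: "finite V" "\<forall>v\<in>V. 0 < v" by (auto simp: V_def)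
  obtain m where m: "\<forall>v. 0 \<le> m v" "\<forall>x\<in>insert 0 V. (\<Sum>v | v \<in> V \<and> v \<le> x. m v) = x"
    using ex_increments[OF V] by blast
  have mem: "x \<in> insert 0 V"
    if "x \<in> a ` set xs \<union> (\<lambda>e. a e + g e) ` set xs" for x
  proof -
    have "0 \<le> x" using that assms by auto
    then show ?thesis using that by (cases "x = 0") (auto simp: V_def)
  qed
  have "\<forall>e\<in>set xs. a e \<in> insert 0 V \<and> a e + g e \<in> insert 0 V"
    by (intro ballI conjI mem) auto
  then show ?thesis using V m by blast
qed

text \<open>Each \<open>u e\<close> is the sum of the increments up to it; exchanging the two sums
  gives the formula.\<close>

lemma layer_cake:
  fixes m u :: "_ \<Rightarrow> real"
  assumes "finite V" "finite T"
    and m: "\<And>x. x \<in> insert 0 V \<Longrightarrow> (\<Sum>v | v \<in> V \<and> v \<le> x. m v) = x"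
    and u: "\<And>e. e \<in> T \<Longrightarrow> u e \<in> insert 0 V"
  shows "sum u T = (\<Sum>v\<in>V. m v * real (card {e \<in> T. v \<le> u e}))"
proof -
  have "sum u T = (\<Sum>e\<in>T. \<Sum>v\<in>V. if v \<le> u e then m v else 0)"
  proof (rule sum.cong[OF refl])
    fix e assume "e \<in> T"
    then show "u e = (\<Sum>v\<in>V. if v \<le> u e then m v else 0)"
      using m[OF u] assms(1) by (simp add: sum.If_cases Int_def)
  qed
  also have "\<dots> = (\<Sum>v\<in>V. \<Sum>e\<in>T. if v \<le> u e then m v else 0)" by (rule sum.swap)
  also have "\<dots> = (\<Sum>v\<in>V. m v * real (card {e \<in> T. v \<le> u e}))"
    using assms(2) by (intro sum.cong) (auto simp: sum.If_cases Int_def mult.commute)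
  finally show ?thesis .
qed

lemma sum_increments_between:
  fixes m :: "real \<Rightarrow> real"
  assumes "finite V"
    and m: "\<And>x. x \<in> insert 0 V \<Longrightarrow> (\<Sum>v | v \<in> V \<and> v \<le> x. m v) = x"
    and "x \<in> insert 0 V" "y \<in> insert 0 V" "x \<le> y"
  shows "(\<Sum>v\<in>V. if x < v \<and> v \<le> y then m v else 0) = y - x"
proof -
  have "(\<Sum>v | v \<in> V \<and> v \<le> y. m v) =
      (\<Sum>v | v \<in> V \<and> v \<le> x. m v) + (\<Sum>v | v \<in> V \<and> x < v \<and> v \<le> y. m v)"
    using assms(1,5) by (subst sum.union_disjoint[symmetric]) (auto intro!: sum.cong)
  then show ?thesis using m assms by (simp add: sum.If_cases Int_def)
qed

subsection \<open>Weights along the stream for one matroid\<close>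

context matroid
begin

text \<open>Here \<open>P\<close> is the set of earlier arrivals, of which those with positive
  \<open>g\<close> are selected, and \<open>a e\<close> plays the role of \<open>w_star\<close> at
  the arrival of \<open>e\<close>. Only \<open>v > 0\<close> is tested because the value 0 is a
  default that need not witness any span. A loop has infinite \<open>w_star\<close>, which no real
  records, so for it only \<open>g e = 0\<close> is kept.\<close>

definition tracks :: "('a \<Rightarrow> real) \<Rightarrow> ('a \<Rightarrow> real) \<Rightarrow> 'a set \<Rightarrow> 'a \<Rightarrow> bool" where
  "tracks a g P e \<longleftrightarrow>
     (if {e} \<in> \<I> then \<forall>v>0. e \<in> matroid_span E \<I> {f \<in> P. 0 < g f \<and> v \<le> a f + g f} \<longleftrightarrow> v \<le> a e
      else g e = 0)"

definition tracks_list :: "('a \<Rightarrow> real) \<Rightarrow> ('a \<Rightarrow> real) \<Rightarrow> 'a list \<Rightarrow> bool" where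
  "tracks_list a g xs \<longleftrightarrow> (\<forall>ys e zs. xs = ys @ e # zs \<longrightarrow> tracks a g (set ys) e)"

lemma tracks_list_Nil: "tracks_list a g []"
  by (simp add: tracks_list_def)

lemma tracks_list_snoc: "tracks_list a g (xs @ [e]) \<longleftrightarrow> tracks_list a g xs \<and> tracks a g (set xs) e"
proof
  assume L: "tracks_list a g (xs @ [e])"
  then have "tracks a g (set ys) f" if "xs = ys @ f # zs" for ys f zs
    using that unfolding tracks_list_def by (metis append_Cons append_assoc)
  then show "tracks_list a g xs \<and> tracks a g (set xs) e"
    using L unfolding tracks_list_def by blast
next
  assume R: "tracks_list a g xs \<and> tracks a g (set xs) e"
  show "tracks_list a g (xs @ [e])"
    unfolding tracks_list_def
  proof (intro allI impI)
    fix ys f zs assume eq: "xs @ [e] = ys @ f # zs"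
    show "tracks a g (set ys) f"
    proof (cases zs rule: rev_cases)
      case Nil
      then show ?thesis using eq R by simp
    next
      case (snoc zs' z)
      then have "xs = ys @ f # zs'" using eq by simp
      then show ?thesis using R unfolding tracks_list_def by blast
    qed
  qed
qed

lemma tracks_cong:
  assumes "\<And>f. f \<in> insert e P \<Longrightarrow> a f = a' f \<and> g f = g' f"
  shows "tracks a g P e \<longleftrightarrow> tracks a' g' P e"
proof -
  have "{f \<in> P. 0 < g f \<and> v \<le> a f + g f} = {f \<in> P. 0 < g' f \<and> v \<le> a' f + g' f}" for v
    using assms by auto
  then show ?thesis using assms[of e] by (simp add: tracks_def)
qed

lemma tracks_list_cong:
  assumes "\<And>f. f \<in> set xs \<Longrightarrow> a f = a' f \<and> g f = g' f"
  shows "tracks_list a g xs \<longleftrightarrow> tracks_list a' g' xs"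
  using assms
proof (induction xs rule: rev_induct)
  case (snoc e xs)
  have "tracks a g (set xs) e \<longleftrightarrow> tracks a' g' (set xs) e"
    by (rule tracks_cong) (use snoc.prems in auto)
  then show ?case using snoc by (simp add: tracks_list_snoc)
qed (simp add: tracks_list_Nil)

text \<open>An arrival can raise the rank at level \<open>v\<close> only if
  \<open>a e < v \<le> a e + g e\<close>, and the increments in this interval sum to
  \<open>g e\<close>. Loops are filtered out of the levels, since \<open>tracks\<close> leaves their
  \<open>a\<close> arbitrary.\<close>

lemma layered_rank_le:
  fixes m :: "real \<Rightarrow> real"
  assumes V: "finite V" "\<forall>v\<in>V. 0 < v" "\<And>v. 0 \<le> m v"
    and m: "\<And>x. x \<in> insert 0 V \<Longrightarrow> (\<Sum>v | v \<in> V \<and> v \<le> x. m v) = x"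
    and g: "\<And>e. 0 \<le> g e"
  shows "tracks_list a g xs \<Longrightarrow> distinct xs \<Longrightarrow> set xs \<subseteq> E \<Longrightarrow>
    \<forall>e\<in>set xs. a e \<in> insert 0 V \<and> a e + g e \<in> insert 0 V \<Longrightarrow>
    (\<Sum>v\<in>V. m v * real (matroid_rank \<I> {f \<in> set xs. {f} \<in> \<I> \<and> v \<le> a f + g f})) \<le> sum g (set xs)"
proof (induction xs rule: rev_induct)
  case Nil
  then show ?case by (simp add: rank_empty)
next
  case (snoc e xs)
  define L where "L X v = {f \<in> X. {f} \<in> \<I> \<and> v \<le> a f + g f}" for X v
  have tr: "tracks_list a g xs" "tracks a g (set xs) e"
    using snoc.prems(1) by (auto simp: tracks_list_snoc)
  have eE: "e \<in> E" using snoc.prems by simp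
  have IH: "(\<Sum>v\<in>V. m v * real (matroid_rank \<I> (L (set xs) v))) \<le> sum g (set xs)"
    using snoc tr by (simp add: L_def)
  show ?case
  proof (cases "{e} \<in> \<I>")
    case False
    then have "L (insert e (set xs)) v = L (set xs) v" for v by (auto simp: L_def)
    then show ?thesis using IH snoc.prems(2) g[of e] by (simp add: L_def)
  next
    case True
    have step: "real (matroid_rank \<I> (L (insert e (set xs)) v)) \<le>
        real (matroid_rank \<I> (L (set xs) v)) + (if a e < v \<and> v \<le> a e + g e then 1 else 0)"
      if "v \<in> V" for v
    proof (cases "v \<le> a e + g e")
      case False
      then have "L (insert e (set xs)) v = L (set xs) v" by (auto simp: L_def)
      then show ?thesis using False by simp
    next
      case le: True
      then have ins: "L (insert e (set xs)) v = insert e (L (set xs) v)"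
        using True by (auto simp: L_def)
      have "e \<in> matroid_span E \<I> (L (set xs) v)" if "v \<le> a e"
      proof -
        have "e \<in> matroid_span E \<I> {f \<in> set xs. 0 < g f \<and> v \<le> a f + g f}"
          using tr(2) True that V(2) \<open>v \<in> V\<close> by (simp add: tracks_def)
        \<comment> \<open>A selected element is never a loop, because \<open>tracks\<close> forces
          \<open>g = 0\<close> on loops.\<close>
        moreover have "{f \<in> set xs. 0 < g f \<and> v \<le> a f + g f} \<subseteq> L (set xs) v"
        proof -
          have "{f} \<in> \<I>" if "f \<in> set xs" "0 < g f" for f
          proof -
            obtain ys zs where "xs = ys @ f # zs" using \<open>f \<in> set xs\<close> by (meson split_list)
            then have "tracks a g (set ys) f" using tr(1) by (auto simp: tracks_list_def)
            then show ?thesis using that by (auto simp: tracks_def split: if_splits)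
          qed
          then show ?thesis by (auto simp: L_def)
        qed
        ultimately show ?thesis using span_mono by blast
      qed
      then show ?thesis using le by (simp add: ins rank_insert[OF eE])
    qed
    have "(\<Sum>v\<in>V. m v * real (matroid_rank \<I> (L (insert e (set xs)) v))) \<le>
        (\<Sum>v\<in>V. m v * real (matroid_rank \<I> (L (set xs) v))
           + (if a e < v \<and> v \<le> a e + g e then m v else 0))"
      using mult_left_mono[OF step V(3)] by (intro sum_mono) (fastforce simp: distrib_left)
    also have "\<dots> = (\<Sum>v\<in>V. m v * real (matroid_rank \<I> (L (set xs) v))) + g e"
      using sum_increments_between[OF V(1) m, of "a e" "a e + g e"] snoc.prems(4) g[of e]
      by (simp add: sum.distrib)
    finally show ?thesis using IH snoc.prems(2) by (simp add: L_def)
  qed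
qed

text \<open>For \<open>a e < v \<le> a e + g e\<close> not even all earlier selected elements of
  level \<open>v\<close> span \<open>e\<close>, so by \<open>span_mono\<close> those in
  \<open>X\<close> do not either, and the rank rises by one. At other levels monotonicity of the
  rank suffices.\<close>

lemma layered_rank_ge:
  fixes m :: "real \<Rightarrow> real"
  assumes V: "finite V" "\<forall>v\<in>V. 0 < v" "\<And>v. 0 \<le> m v"
    and m: "\<And>x. x \<in> insert 0 V \<Longrightarrow> (\<Sum>v | v \<in> V \<and> v \<le> x. m v) = x"
  shows "tracks_list a g xs \<Longrightarrow> distinct xs \<Longrightarrow> set xs \<subseteq> E \<Longrightarrow>
    \<forall>e\<in>set xs. a e \<in> insert 0 V \<and> a e + g e \<in> insert 0 V \<Longrightarrow>
    X \<subseteq> set xs \<Longrightarrow> \<forall>e\<in>X. 0 < g e \<Longrightarrow>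
    sum g X \<le> (\<Sum>v\<in>V. m v * real (matroid_rank \<I> {f \<in> X. v \<le> a f + g f}))"
proof (induction xs arbitrary: X rule: rev_induct)
  case Nil
  then show ?case by (simp add: rank_empty)
next
  case (snoc e xs)
  define L where "L X v = {f \<in> X. v \<le> a f + g f}" for X v
  have tr: "tracks_list a g xs" "tracks a g (set xs) e"
    using snoc.prems(1) by (auto simp: tracks_list_snoc)
  have eE: "e \<in> E" using snoc.prems by simp
  have IH: "sum g Y \<le> (\<Sum>v\<in>V. m v * real (matroid_rank \<I> (L Y v)))"
    if "Y \<subseteq> set xs" "\<forall>e\<in>Y. 0 < g e" for Y
    using snoc.IH[of Y] snoc.prems tr that by (simp add: L_def)
  show ?case
  proof (cases "e \<in> X")
    case False
    then show ?thesis using IH[of X] snoc.prems by (auto simp: L_def)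
  next
    case True
    define Y where "Y = X - {e}"
    have X: "X = insert e Y" "e \<notin> Y" using True by (auto simp: Y_def)
    have Y: "Y \<subseteq> set xs" "\<forall>e\<in>Y. 0 < g e" using snoc.prems by (auto simp: Y_def)
    have ge: "0 < g e" using True snoc.prems by simp
    have nonloop: "{e} \<in> \<I>" using tr(2) ge by (auto simp: tracks_def split: if_splits)
    have step: "real (matroid_rank \<I> (L Y v)) + (if a e < v \<and> v \<le> a e + g e then 1 else 0)
        \<le> real (matroid_rank \<I> (L X v))" if "v \<in> V" for v
    proof (cases "a e < v \<and> v \<le> a e + g e")
      case False
      then show ?thesis using X by (auto simp: L_def intro!: rank_mono)
    next
      case in_between: True
      then have "e \<notin> matroid_span E \<I> {f \<in> set xs. 0 < g f \<and> v \<le> a f + g f}"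
        using tr(2) nonloop V(2) that by (auto simp: tracks_def)
      moreover have "L Y v \<subseteq> {f \<in> set xs. 0 < g f \<and> v \<le> a f + g f}"
        using Y by (auto simp: L_def)
      ultimately have "e \<notin> matroid_span E \<I> (L Y v)" using span_mono by blast
      moreover have "L X v = insert e (L Y v)" using in_between X by (auto simp: L_def)
      ultimately show ?thesis by (simp add: rank_insert[OF eE])
    qed
    have fin: "finite Y" using Y(1) finite_subset by blast
    have "sum g X = sum g Y + g e" using X fin by simp
    also have "\<dots> \<le> (\<Sum>v\<in>V. m v * real (matroid_rank \<I> (L Y v))) + g e"
      using IH[OF Y] by simp
    also have "\<dots> = (\<Sum>v\<in>V. m v * real (matroid_rank \<I> (L Y v))
           + (if a e < v \<and> v \<le> a e + g e then m v else 0))"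
      using sum_increments_between[OF V(1) m, of "a e" "a e + g e"] snoc.prems(4) ge
      by (simp add: sum.distrib)
    also have "\<dots> \<le> (\<Sum>v\<in>V. m v * real (matroid_rank \<I> (L X v)))"
      using mult_left_mono[OF step V(3)] by (intro sum_mono) (fastforce simp: distrib_left)
    finally show ?thesis by (simp add: L_def)
  qed
qed

text \<open>Every level set of \<open>I\<close> is independent and free of loops, so its size is
  bounded by the rank summed in \<open>layered_rank_le\<close>.\<close>

lemma indep_weight_le:
  assumes "tracks_list a g xs" "distinct xs" "set xs \<subseteq> E"
    and "\<And>e. 0 \<le> a e" "\<And>e. 0 \<le> g e" "I \<in> \<I>" "I \<subseteq> set xs"
  shows "(\<Sum>e\<in>I. a e + g e) \<le> sum g (set xs)"
proof -
  obtain V m where V: "finite V" "\<forall>v\<in>V. 0 < v" "\<And>v. 0 \<le> m v"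
    "\<And>x. x \<in> insert 0 V \<Longrightarrow> (\<Sum>v | v \<in> V \<and> v \<le> x. m v) = x"
    "\<forall>e\<in>set xs. a e \<in> insert 0 V \<and> a e + g e \<in> insert 0 V"
    using ex_increments_at_levels[of a g xs, OF assms(4,5)] by blast
  have "card {e \<in> I. v \<le> a e + g e} \<le>
      matroid_rank \<I> {f \<in> set xs. {f} \<in> \<I> \<and> v \<le> a f + g f}" for v
    using assms(7) indep_mono[OF assms(6)] by (intro card_le_rank indep_mono[OF assms(6)]) auto
  then have "(\<Sum>v\<in>V. m v * real (card {e \<in> I. v \<le> a e + g e})) \<le>
      (\<Sum>v\<in>V. m v * real (matroid_rank \<I> {f \<in> set xs. {f} \<in> \<I> \<and> v \<le> a f + g f}))"
    using V(3) by (intro sum_mono mult_left_mono) auto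
  also have "\<dots> \<le> sum g (set xs)"
    using layered_rank_le[OF V(1-4) assms(5,1-3) V(5)] .
  also have "(\<Sum>v\<in>V. m v * real (card {e \<in> I. v \<le> a e + g e})) = (\<Sum>e\<in>I. a e + g e)"
    using V(5) assms(7) by (intro layer_cake[OF V(1) finite_indep[OF assms(6)] V(4), symmetric]) auto
  finally show ?thesis .
qed

text \<open>The greedy basis meets every level set in a basis of it, so the layered rank of
  \<open>X\<close> is exactly the weight of the greedy basis.\<close>

lemma greedy_weight_ge:
  assumes "tracks_list a g xs" "distinct xs" "set xs \<subseteq> E"
    and "\<And>e. 0 \<le> a e" "\<And>e. 0 \<le> g e" "X \<subseteq> set xs" "\<forall>e\<in>X. 0 < g e"
    and "inj_on r X"
    and "\<And>e f. e \<in> X \<Longrightarrow> f \<in> X \<Longrightarrow> r e < r f \<Longrightarrow> a e + g e \<le> a f + g f"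
  shows "sum g X \<le> (\<Sum>e\<in>greedy r X. a e + g e)"
proof -
  obtain V m where V: "finite V" "\<forall>v\<in>V. 0 < v" "\<And>v. 0 \<le> m v"
    "\<And>x. x \<in> insert 0 V \<Longrightarrow> (\<Sum>v | v \<in> V \<and> v \<le> x. m v) = x"
    "\<forall>e\<in>set xs. a e \<in> insert 0 V \<and> a e + g e \<in> insert 0 V"
    using ex_increments_at_levels[of a g xs, OF assms(4,5)] by blast
  have X: "finite X" "X \<subseteq> E" using assms(3,6) finite_subset by auto
  have "sum g X \<le> (\<Sum>v\<in>V. m v * real (matroid_rank \<I> {f \<in> X. v \<le> a f + g f}))"
    using layered_rank_ge[OF V(1-4) assms(1-3) V(5) assms(6,7)] .
  also have "\<dots> = (\<Sum>v\<in>V. m v * real (card {f \<in> greedy r X. v \<le> a f + g f}))"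
    using card_greedy_level[OF X assms(8,9)] by simp
  also have "\<dots> = (\<Sum>e\<in>greedy r X. a e + g e)"
    using V(5) assms(6) greedy_subset[of r X]
    by (intro layer_cake[OF V(1) finite_subset[OF greedy_subset X(1)] V(4), symmetric]) blast+
  finally show ?thesis .
qed

text \<open>The supremum is attained. If it were infinite, \<open>e\<close> would be spanned by the
  empty set of elements of infinite weight and would be a loop. Below the attained value, lowering
  the threshold only enlarges the spanning set.\<close>

lemma w_star_nonloop:
  assumes "finite S" "e \<in> E" "{e} \<in> \<I>"
  shows "\<exists>x. w_star E \<I> S u e = ereal x \<and>
    (\<forall>v>0. e \<in> matroid_span E \<I> {f \<in> S. v \<le> u f} \<longleftrightarrow> v \<le> x)"
proof -
  let ?s = "w_star E \<I> S u e"
  have pos: "0 \<le> ?s" unfolding w_star_def by (rule Sup_upper) simp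
  have att: "?s = 0 \<or> e \<in> matroid_span E \<I> {f \<in> S. ?s \<le> ereal (u f)}"
    using w_star_attained[OF assms(1), of E \<I> u e] by auto
  have "?s \<noteq> \<infinity>" using att nonloop_iff[OF assms(2)] assms(3) by auto
  then obtain x where x: "?s = ereal x" using pos by (cases ?s) auto
  have "e \<in> matroid_span E \<I> {f \<in> S. v \<le> u f} \<longleftrightarrow> v \<le> x" if "0 < v" for v
  proof
    assume "e \<in> matroid_span E \<I> {f \<in> S. v \<le> u f}"
    then have "ereal v \<le> ?s" unfolding w_star_def by (intro Sup_upper) simp
    then show "v \<le> x" using x by simp
  next
    assume le: "v \<le> x"
    then have "e \<in> matroid_span E \<I> {f \<in> S. x \<le> u f}" using att x that by auto
    moreover have "{f \<in> S. x \<le> u f} \<subseteq> {f \<in> S. v \<le> u f}" using le by auto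
    ultimately show "e \<in> matroid_span E \<I> {f \<in> S. v \<le> u f}" using span_mono by blast
  qed
  then show ?thesis using x by blast
qed

lemma w_star_loop:
  assumes "e \<in> E" "{e} \<notin> \<I>"
  shows "w_star E \<I> S u e = \<infinity>"
proof -
  have "\<infinity> \<le> w_star E \<I> S u e" unfolding w_star_def
    using assms nonloop_iff[OF assms(1)] by (intro Sup_upper) auto
  then show ?thesis by simp
qed

text \<open>On an accepting step \<open>y\<close> is the gain, on a rejecting step \<open>y = 0\<close>. When \<open>e\<close> is a loop,
  \<open>x\<close> is the junk value \<open>real_of_ereal \<infinity> = 0\<close>.\<close>

lemma tracks_list_extend:
  assumes "tracks_list a g xs" "e \<in> E" "e \<notin> set xs"
    and "S = {f \<in> set xs. 0 < g f}" "\<forall>f\<in>S. u f = a f + g f"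
    and x: "x = real_of_ereal (w_star E \<I> S u e)" and y: "{e} \<notin> \<I> \<Longrightarrow> y = 0"
  shows "tracks_list (a(e := x)) (g(e := y)) (xs @ [e])"
proof -
  have "tracks_list (a(e := x)) (g(e := y)) xs"
    using assms(1) by (rule iffD1[OF tracks_list_cong, rotated]) (use assms(3) in auto)
  moreover have "tracks (a(e := x)) (g(e := y)) (set xs) e"
  proof (cases "{e} \<in> \<I>")
    case True
    have "finite S" using assms(4) by simp
    then obtain z where z: "w_star E \<I> S u e = ereal z"
      "\<And>v. 0 < v \<Longrightarrow> e \<in> matroid_span E \<I> {f \<in> S. v \<le> u f} \<longleftrightarrow> v \<le> z"
      using w_star_nonloop[OF \<open>finite S\<close> assms(2) True, of u] by blast
    have "{f \<in> set xs. 0 < (g(e := y)) f \<and> v \<le> (a(e := x)) f + (g(e := y)) f} =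
        {f \<in> S. v \<le> u f}" for v
      using assms(3-5) by auto
    then show ?thesis using z x True by (simp add: tracks_def)
  qed (simp add: tracks_def y)
  ultimately show ?thesis by (simp add: tracks_list_snoc)
qed

end

subsection \<open>Kernels of two matroids\<close>

text \<open>The rejected part of a set is monotone in the set, by \<open>span_mono\<close>. The two
  complements in \<open>F\<close> reverse inclusion twice, so \<open>F\<close> is monotone and
  Knaster-Tarski yields a fixed point.\<close>

lemma ex_kernel:
  assumes "matroid E \<I>\<^sub>1" "matroid E \<I>\<^sub>2"
  shows "\<exists>X\<^sub>1 X\<^sub>2. X\<^sub>1 \<union> X\<^sub>2 = S \<and>
    matroid.greedy E \<I>\<^sub>1 r\<^sub>1 X\<^sub>1 = X\<^sub>1 \<inter> X\<^sub>2 \<and> matroid.greedy E \<I>\<^sub>2 r\<^sub>2 X\<^sub>2 = X\<^sub>1 \<inter> X\<^sub>2"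
proof -
  interpret M1: matroid E \<I>\<^sub>1 by fact
  interpret M2: matroid E \<I>\<^sub>2 by fact
  define R1 where "R1 X = {e \<in> X. e \<in> matroid_span E \<I>\<^sub>1 {f \<in> X. r\<^sub>1 e < r\<^sub>1 f}}" for X
  define R2 where "R2 X = {e \<in> X. e \<in> matroid_span E \<I>\<^sub>2 {f \<in> X. r\<^sub>2 e < r\<^sub>2 f}}" for X
  have mono1: "R1 X \<subseteq> R1 Y" if "X \<subseteq> Y" for X Y
  proof -
    have "matroid_span E \<I>\<^sub>1 {f \<in> X. r\<^sub>1 e < r\<^sub>1 f} \<subseteq> matroid_span E \<I>\<^sub>1 {f \<in> Y. r\<^sub>1 e < r\<^sub>1 f}" for e
      using that by (intro M1.span_mono) auto
    then show ?thesis using that by (auto simp: R1_def)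
  qed
  have mono2: "R2 X \<subseteq> R2 Y" if "X \<subseteq> Y" for X Y
  proof -
    have "matroid_span E \<I>\<^sub>2 {f \<in> X. r\<^sub>2 e < r\<^sub>2 f} \<subseteq> matroid_span E \<I>\<^sub>2 {f \<in> Y. r\<^sub>2 e < r\<^sub>2 f}" for e
      using that by (intro M2.span_mono) auto
    then show ?thesis using that by (auto simp: R2_def)
  qed
  define F where "F X = S - R2 (S - R1 X)" for X
  have "mono F" unfolding F_def by (intro monoI Diff_mono order_refl mono1 mono2)
  define X1 where "X1 = lfp F"
  define X2 where "X2 = S - R1 X1"
  have X1: "X1 = S - R2 X2" using lfp_unfold[OF \<open>mono F\<close>] by (simp add: X1_def X2_def F_def)
  have sub: "R1 X1 \<subseteq> X1" "R2 X2 \<subseteq> X2" by (auto simp: R1_def R2_def)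
  have greedy: "M1.greedy r\<^sub>1 X1 = X1 - R1 X1" "M2.greedy r\<^sub>2 X2 = X2 - R2 X2"
    by (auto simp: M1.greedy_def M2.greedy_def R1_def R2_def)
  \<comment> \<open>\<open>S - X2\<close> is exactly what the first matroid rejects from
    \<open>X1\<close>, and \<open>S - X1\<close> what the second rejects from \<open>X2\<close>; in
    both cases \<open>X1 \<inter> X2\<close> remains.\<close>
  have "A \<union> B = S \<and> A - P = A \<inter> B \<and> B - Q = A \<inter> B"
    if "A = S - Q" "B = S - P" "P \<subseteq> A" "Q \<subseteq> B" for A B P Q
    using that by auto
  from this[OF X1 X2_def sub]
  have "X1 \<union> X2 = S \<and> M1.greedy r\<^sub>1 X1 = X1 \<inter> X2 \<and> M2.greedy r\<^sub>2 X2 = X1 \<inter> X2"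
    using greedy by simp
  then show ?thesis by blast
qed

subsection \<open>The algorithm\<close>

text \<open>The invariant of the run. The state has weights for selected elements only, whereas
  \<open>a\<^sub>1\<close>, \<open>a\<^sub>2\<close>, \<open>g\<close> also cover discarded ones.
  The bound on \<open>w\<close> is limited to common non-loops, as the infinite threshold of a loop
  is not represented.\<close>

definition lr_history ::
    "'a set \<Rightarrow> 'a set set \<Rightarrow> 'a set set \<Rightarrow> ('a \<Rightarrow> real) \<Rightarrow> 'a list \<Rightarrow> 'a lr_state \<Rightarrow>
     ('a \<Rightarrow> real) \<Rightarrow> ('a \<Rightarrow> real) \<Rightarrow> ('a \<Rightarrow> real) \<Rightarrow> bool" where
  "lr_history E \<I>\<^sub>1 \<I>\<^sub>2 w xs st a\<^sub>1 a\<^sub>2 g \<longleftrightarrow>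
     (\<forall>e. 0 \<le> a\<^sub>1 e \<and> 0 \<le> a\<^sub>2 e \<and> 0 \<le> g e) \<and>
     selected st = {e \<in> set xs. 0 < g e} \<and>
     (\<forall>e\<in>selected st. wt1 st e = a\<^sub>1 e + g e \<and> wt2 st e = a\<^sub>2 e + g e \<and> w e = a\<^sub>1 e + a\<^sub>2 e + g e) \<and>
     (\<forall>e\<in>set xs. {e} \<in> \<I>\<^sub>1 \<longrightarrow> {e} \<in> \<I>\<^sub>2 \<longrightarrow> w e \<le> a\<^sub>1 e + a\<^sub>2 e + g e) \<and>
     matroid.tracks_list E \<I>\<^sub>1 a\<^sub>1 g xs \<and> matroid.tracks_list E \<I>\<^sub>2 a\<^sub>2 g xs"

lemma lr_history_step:
  assumes "matroid E \<I>\<^sub>1" "matroid E \<I>\<^sub>2"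
    and h: "lr_history E \<I>\<^sub>1 \<I>\<^sub>2 w xs st a\<^sub>1 a\<^sub>2 g" and e: "e \<in> E" "e \<notin> set xs"
  shows "\<exists>a\<^sub>1 a\<^sub>2 g. lr_history E \<I>\<^sub>1 \<I>\<^sub>2 w (xs @ [e]) (lr_step E \<I>\<^sub>1 \<I>\<^sub>2 w e st) a\<^sub>1 a\<^sub>2 g"
proof -
  interpret M1: matroid E \<I>\<^sub>1 by fact
  interpret M2: matroid E \<I>\<^sub>2 by fact
  define s1 where "s1 = w_star E \<I>\<^sub>1 (selected st) (wt1 st) e"
  define s2 where "s2 = w_star E \<I>\<^sub>2 (selected st) (wt2 st) e"
  define x1 where "x1 = real_of_ereal s1"
  define x2 where "x2 = real_of_ereal s2"
  define acc where "acc \<longleftrightarrow> ereal (w e) > s1 + s2"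
  define y where "y = (if acc then w e - x1 - x2 else 0)"
  have S: "selected st = {f \<in> set xs. 0 < g f}"
    and u: "\<forall>f\<in>selected st. wt1 st f = a\<^sub>1 f + g f" "\<forall>f\<in>selected st. wt2 st f = a\<^sub>2 f + g f"
    and T: "M1.tracks_list a\<^sub>1 g xs" "M2.tracks_list a\<^sub>2 g xs"
    using h by (auto simp: lr_history_def)
  have nonneg: "0 \<le> s1" "0 \<le> s2" unfolding s1_def s2_def w_star_def by (auto intro: Sup_upper)
  have x_nonneg: "0 \<le> x1" "0 \<le> x2" using nonneg by (auto simp: x1_def x2_def real_of_ereal_pos)
  have fin: "finite (selected st)" using S by simp
  \<comment> \<open>A loop in either matroid makes the sum of the two nonnegative thresholds
    infinite, so it fails the acceptance test.\<close>
  have acc_nonloop: "{e} \<in> \<I>\<^sub>1" "{e} \<in> \<I>\<^sub>2" if acc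
    using that M1.w_star_loop[OF e(1)] M2.w_star_loop[OF e(1)] nonneg
    unfolding acc_def s1_def s2_def by fastforce+
  have s: "s1 + s2 = ereal (x1 + x2)" if nonloop: "{e} \<in> \<I>\<^sub>1" "{e} \<in> \<I>\<^sub>2"
  proof -
    obtain z1 z2 where "s1 = ereal z1" "s2 = ereal z2"
      using M1.w_star_nonloop[OF fin e(1) nonloop(1)] M2.w_star_nonloop[OF fin e(1) nonloop(2)]
      unfolding s1_def s2_def by blast
    then show ?thesis by (simp add: x1_def x2_def)
  qed
  \<comment> \<open>Acceptance is the same as a positive gain, which keeps the selected set equal to
    the set of arrivals with positive \<open>g\<close>.\<close>
  have y_pos: "0 < y \<longleftrightarrow> acc" using s acc_nonloop by (auto simp: y_def acc_def)
  have rej: "w e \<le> x1 + x2 + y" if "{e} \<in> \<I>\<^sub>1" "{e} \<in> \<I>\<^sub>2"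
    using s[OF that] by (auto simp: y_def acc_def)
  have T': "M1.tracks_list (a\<^sub>1(e := x1)) (g(e := y)) (xs @ [e])"
    "M2.tracks_list (a\<^sub>2(e := x2)) (g(e := y)) (xs @ [e])"
    using M1.tracks_list_extend[OF T(1) e S u(1)] M2.tracks_list_extend[OF T(2) e S u(2)]
      acc_nonloop by (auto simp: x1_def x2_def s1_def s2_def y_def)
  have st: "lr_step E \<I>\<^sub>1 \<I>\<^sub>2 w e st = (if acc then
      \<lparr>selected = insert e (selected st), wt1 = (wt1 st)(e := x1 + y), wt2 = (wt2 st)(e := x2 + y)\<rparr>
      else st)"
    by (simp add: lr_step_def Let_def s1_def s2_def x1_def x2_def acc_def y_def)
  have y_nonneg: "0 \<le> y" using y_pos by (cases acc) (auto simp: y_def)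
  have sel: "selected (lr_step E \<I>\<^sub>1 \<I>\<^sub>2 w e st) = {f \<in> set (xs @ [e]). 0 < (g(e := y)) f}"
    using e(2) y_pos by (auto simp: st S)
  have "lr_history E \<I>\<^sub>1 \<I>\<^sub>2 w (xs @ [e]) (lr_step E \<I>\<^sub>1 \<I>\<^sub>2 w e st)
      (a\<^sub>1(e := x1)) (a\<^sub>2(e := x2)) (g(e := y))"
    unfolding lr_history_def
  proof (intro conjI T' sel)
    show "\<forall>f. 0 \<le> (a\<^sub>1(e := x1)) f \<and> 0 \<le> (a\<^sub>2(e := x2)) f \<and> 0 \<le> (g(e := y)) f"
      using h x_nonneg y_nonneg by (simp add: lr_history_def)
    show "\<forall>f\<in>set (xs @ [e]). {f} \<in> \<I>\<^sub>1 \<longrightarrow> {f} \<in> \<I>\<^sub>2 \<longrightarrow>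
        w f \<le> (a\<^sub>1(e := x1)) f + (a\<^sub>2(e := x2)) f + (g(e := y)) f"
      using h rej by (auto simp: lr_history_def)
    have "e \<notin> selected st" using S e(2) by simp
    then show "\<forall>f\<in>selected (lr_step E \<I>\<^sub>1 \<I>\<^sub>2 w e st).
        wt1 (lr_step E \<I>\<^sub>1 \<I>\<^sub>2 w e st) f = (a\<^sub>1(e := x1)) f + (g(e := y)) f \<and>
        wt2 (lr_step E \<I>\<^sub>1 \<I>\<^sub>2 w e st) f = (a\<^sub>2(e := x2)) f + (g(e := y)) f \<and>
        w f = (a\<^sub>1(e := x1)) f + (a\<^sub>2(e := x2)) f + (g(e := y)) f"
      using h by (auto simp: st lr_history_def y_def)
  qed
  then show ?thesis by blast
qed

lemma ex_lr_history:
  assumes "matroid E \<I>\<^sub>1" "matroid E \<I>\<^sub>2"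
  shows "distinct xs \<Longrightarrow> set xs \<subseteq> E \<Longrightarrow>
    \<exists>a\<^sub>1 a\<^sub>2 g. lr_history E \<I>\<^sub>1 \<I>\<^sub>2 w xs (fold (lr_step E \<I>\<^sub>1 \<I>\<^sub>2 w) xs lr_init) a\<^sub>1 a\<^sub>2 g"
proof (induction xs rule: rev_induct)
  case Nil
  then show ?case
    using matroid.tracks_list_Nil[OF assms(1)] matroid.tracks_list_Nil[OF assms(2)]
    by (intro exI[of _ "\<lambda>_. 0"]) (simp add: lr_history_def lr_init_def)
next
  case (snoc e xs)
  then show ?case using lr_history_step[OF assms] by fastforce
qed

theorem theorem3p2:
  fixes E :: "'a set" and \<I>\<^sub>1 \<I>\<^sub>2 :: "'a set set"
    and w :: "'a \<Rightarrow> real" and stream :: "'a list" and Sstar :: "'a set"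
  assumes "matroid E \<I>\<^sub>1" and "matroid E \<I>\<^sub>2"
    and "\<forall>e\<in>E. 0 \<le> w e"
    and "distinct stream" and "set stream = E"
    and "optimal_common_indep \<I>\<^sub>1 \<I>\<^sub>2 w Sstar"
  shows "\<exists>T \<subseteq> lr_output E \<I>\<^sub>1 \<I>\<^sub>2 w stream.
           T \<in> \<I>\<^sub>1 \<and> T \<in> \<I>\<^sub>2 \<and> sum w T \<ge> sum w Sstar / 2"
proof -
  interpret M1: matroid E \<I>\<^sub>1 by fact
  interpret M2: matroid E \<I>\<^sub>2 by fact
  define S where "S = lr_output E \<I>\<^sub>1 \<I>\<^sub>2 w stream"
  obtain a1 a2 g where
    h: "lr_history E \<I>\<^sub>1 \<I>\<^sub>2 w stream (fold (lr_step E \<I>\<^sub>1 \<I>\<^sub>2 w) stream lr_init) a1 a2 g"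
    using ex_lr_history[OF assms(1,2,4)] assms(5) by blast
  have nonneg: "\<And>e. 0 \<le> a1 e" "\<And>e. 0 \<le> a2 e" "\<And>e. 0 \<le> g e"
    and S: "S = {e \<in> E. 0 < g e}"
    and wS: "\<And>e. e \<in> S \<Longrightarrow> w e = (a1 e + g e) + (a2 e + g e) - g e"
    and wE: "\<And>e. e \<in> E \<Longrightarrow> {e} \<in> \<I>\<^sub>1 \<Longrightarrow> {e} \<in> \<I>\<^sub>2 \<Longrightarrow> w e \<le> a1 e + a2 e + g e"
    and T: "M1.tracks_list a1 g stream" "M2.tracks_list a2 g stream"
    using h assms(5) by (auto simp: lr_history_def S_def lr_output_def)
  have sE: "set stream \<subseteq> E" using assms(5) by simp
  have SE: "S \<subseteq> E" "finite S" using S M1.finite_ground by auto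
  have gS: "sum g E = sum g S"
    using M1.finite_ground nonneg(3) S
    by (intro sum.mono_neutral_right) (auto simp: not_less order_antisym)
  have opt: "Sstar \<in> \<I>\<^sub>1" "Sstar \<in> \<I>\<^sub>2" using assms(6) by (auto simp: optimal_common_indep_def)
  have optE: "Sstar \<subseteq> set stream" using M1.indep_subset_ground[OF opt(1)] assms(5) by simp
  \<comment> \<open>Members of an independent set are non-loops, so \<open>wE\<close> applies;
    counting \<open>g e\<close> twice only weakens the bound and splits it into one weight per
    matroid.\<close>
  have "sum w Sstar \<le> (\<Sum>e\<in>Sstar. (a1 e + g e) + (a2 e + g e))"
  proof (rule sum_mono)
    fix e assume e: "e \<in> Sstar"
    then have "{e} \<in> \<I>\<^sub>1" "{e} \<in> \<I>\<^sub>2" "e \<in> E"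
      using M1.indep_mono[OF opt(1)] M2.indep_mono[OF opt(2)] optE assms(5) by auto
    then show "w e \<le> (a1 e + g e) + (a2 e + g e)" using wE[of e] nonneg(3)[of e] by simp
  qed
  also have "\<dots> = (\<Sum>e\<in>Sstar. a1 e + g e) + (\<Sum>e\<in>Sstar. a2 e + g e)" by (rule sum.distrib)
  also have "\<dots> \<le> sum g S + sum g S"
    using M1.indep_weight_le[OF T(1) assms(4) sE nonneg(1,3) opt(1) optE]
      M2.indep_weight_le[OF T(2) assms(4) sE nonneg(2,3) opt(2) optE] gS assms(5)
    by (intro add_mono) auto
  finally have upper: "sum w Sstar \<le> 2 * sum g S" by simp
  obtain r1 :: "'a \<Rightarrow> nat" where
    r1: "inj_on r1 S" "\<forall>e\<in>S. \<forall>f\<in>S. r1 e < r1 f \<longrightarrow> a1 e + g e \<le> a1 f + g f"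
    using ex_refining_ranking[OF SE(2), of "\<lambda>e. a1 e + g e"] by blast
  obtain r2 :: "'a \<Rightarrow> nat" where
    r2: "inj_on r2 S" "\<forall>e\<in>S. \<forall>f\<in>S. r2 e < r2 f \<longrightarrow> a2 e + g e \<le> a2 f + g f"
    using ex_refining_ranking[OF SE(2), of "\<lambda>e. a2 e + g e"] by blast
  obtain X1 X2 where X: "X1 \<union> X2 = S" "M1.greedy r1 X1 = X1 \<inter> X2" "M2.greedy r2 X2 = X1 \<inter> X2"
    using ex_kernel[OF assms(1,2), of S r1 r2] by blast
  have sub: "X1 \<subseteq> S" "X2 \<subseteq> S" using X(1) by auto
  have fin: "finite X1" "finite X2" using sub SE(2) finite_subset by auto
  have inj: "inj_on r1 X1" "inj_on r2 X2" using r1(1) r2(1) sub inj_on_subset by blast+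
  \<comment> \<open>The same set is a greedy basis of \<open>X1\<close> in the first matroid and of
    \<open>X2\<close> in the second.\<close>
  have indep: "X1 \<inter> X2 \<in> \<I>\<^sub>1" "X1 \<inter> X2 \<in> \<I>\<^sub>2"
    using M1.greedy_basis[OF fin(1) _ inj(1)] M2.greedy_basis[OF fin(2) _ inj(2)] X sub SE(1) by auto
  have X_stream: "X1 \<subseteq> set stream" "X2 \<subseteq> set stream" using sub SE(1) assms(5) by auto
  have X_pos: "\<forall>e\<in>X1. 0 < g e" "\<forall>e\<in>X2. 0 < g e" using sub S by auto
  have "sum g X1 \<le> (\<Sum>e\<in>M1.greedy r1 X1. a1 e + g e)"
    by (rule M1.greedy_weight_ge[OF T(1) assms(4) sE nonneg(1,3) X_stream(1) X_pos(1) inj(1)])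
      (use r1(2) sub in blast)
  moreover have "sum g X2 \<le> (\<Sum>e\<in>M2.greedy r2 X2. a2 e + g e)"
    by (rule M2.greedy_weight_ge[OF T(2) assms(4) sE nonneg(2,3) X_stream(2) X_pos(2) inj(2)])
      (use r2(2) sub in blast)
  \<comment> \<open>The overlap \<open>sum g (X1 \<inter> X2)\<close> counted twice here cancels the
    \<open>g\<close> subtracted in \<open>w = u1 + u2 - g\<close>, where
    \<open>ui = ai + g\<close>.\<close>
  moreover have "sum g X1 + sum g X2 = sum g S + sum g (X1 \<inter> X2)"
    using sum.union_inter[OF fin, of g] X(1) by simp
  moreover have "sum w (X1 \<inter> X2) =
      (\<Sum>e\<in>X1 \<inter> X2. a1 e + g e) + (\<Sum>e\<in>X1 \<inter> X2. a2 e + g e) - sum g (X1 \<inter> X2)"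
    unfolding sum.distrib[symmetric] sum_subtractf[symmetric]
    using sub by (intro sum.cong refl wS) auto
  ultimately have "sum w (X1 \<inter> X2) \<ge> sum g S" unfolding X(2,3) by linarith
  then show ?thesis using upper indep sub unfolding S_def[symmetric]
    by (intro exI[of _ "X1 \<inter> X2"]) auto
qed

end
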